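(* (Dominance rule for special case I.) Let $\boldsymbol\lambda\in\mathbb R^{|W|}$ be fixed, let $T\ge\max_{P\in\mathcal P}\sum_{(i,j)\in P}\frac{\mathbf d(i,j)}{\underline\tau}$, and let $\bar v\in I$ be fixed. Let $L^1,L^2$ be labels such that (i) $L^1$ and $L^2$ end at the same waypoint; (ii) $M(L^1)\subseteq M(L^2)$. Then the following hold. 1. If either $\bar v\in M(L^1)$ and $\bar v\in M(L^2)$, or $\bar v\notin M(L^1)$ and $\bar v\notin M(L^2)$, then $L^1$ dominates $L^2$ if $c_{\bar v}(L^1)\ge c_{\bar v}(L^2)$. 2. If $\bar v\notin M(L^1)$ but $\bar v\in M(L^2)$, and $\bar v\in V^0$, let $$c^{extra}_{\bar v}(L^2)=\min_{i\in V^0,\ i\notin M(L^2)}\Big\{c^*_{(i,\bar v),\bar v}+c^*_{(\bar v,n+1),\bar v}-c^*_{(i,n+1),\bar v}\Big\}$$ (the worst-case extra cost incurred by adjusting a direct application to $L^1$ of an extension of $L^2$ in order to accommodate the visit to $\bar v$). If $c_{\bar v}(L^1)+c^{extra}_{\bar v}(L^2)\ge c_{\bar v}(L^2)$, then $L^1$ dominates $L^2$. (The remaining combination, $\bar v\in M(L^1)$ but $\bar v\notin M(L^2)$, is impossible because of (ii). One defines $c^{extra}_0(L^2):=0$.) Here "$L^1$ dominates $L^2$" means that for every extension of $L^2$ to a feasible complete path $Q^2$ there is an extension of $L^1$ to a feasible complete path $Q^1$ with $c_{\bar v}(Q^1)\ge c_{\bar v}(Q^2)$, so that $L^2$ can be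 discarded.
   Context: $V=\{0,1,\dots,n,n+1\}$ is a finite set of waypoints (points in the plane), with $0$ and $n+1$ the depots, $V^0=V\setminus\{0,n+1\}$, $W$ is a finite set of targets (points in the plane), and $A=((V\setminus\{n+1\})\times V)\setminus(\{(i,i):i\in V\}\cup\{(0,n+1)\})$. $\mathbf d(\cdot,\cdot)$ is Euclidean distance, with $\mathbf d(i,j)>0$ for $(i,j)\in A$. $\mathcal P$ is the set of paths from $0$ to $n+1$ using arcs of $A$ and visiting each waypoint at most once. $\bar p_w$ is the priority of target $w$, $0<\underline\tau\le\bar\tau$ are the minimum and maximum vehicle speeds, and $T$ is the operational deadline (the assumption on $T$ makes every path in $\mathcal P$ time-feasible). Vehicles are identical, with coverage radius $\bar\eta$ and coverage factor $\rho$. For $(i,j)\in A$ and $w\in W$, let $[i',j']$ be the intersection of the segment $[i,j]$ with the disc of radius $\bar\eta$ about $w$, let $\bar\theta$ be the angle at $w$ between the vectors from $w$ to $i'$ and from $w$ to $j'$, and put $\bar d_{ijw}=\mathbf d(i',j')$ and $c_{ijw}=\rho\frac{\bar\theta}{\sin\bar\theta\,\mathbf d(i',w)\,\mathbf d(j',w)}$ (with $\theta/\sin\theta=1$ at $\theta=0$, and $c_{ijw}\bar d_{ijw}=0$ if the intersection is empty). For $i\in V^0$, $c_{iw}=\rho/\mathbf d(i,w)^2$ if $\mathbf d(i,w)\le\bar\eta$, else $0$; and $c_{0w}=0$. All coefficients are taken to be well-defined finite real numbers. $I=\{i\in V^0:\sum_{w\in W}(\bar p_w-\lambda_w)c_{iw}>0\}\cup\{0\}$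 is the set of candidate idling waypoints; $\bar v=0$ encodes that no idling occurs. For $(i,j)\in A$ put $g_{ij}=\sum_{w\in W}(\bar p_w-\lambda_w)\big(\frac{\bar d_{ijw}}{\mathbf d(i,j)}c_{ijw}-c_{\bar vw}\big)$. Let $t^*_{ij\bar v}=\mathbf d(i,j)/\underline\tau$ if $g_{ij}>0$ and $t^*_{ij\bar v}=\mathbf d(i,j)/\bar\tau$ if $g_{ij}\le0$. The optimal adjusted coverage of the arc is $c^*_{(i,j),\bar v}=g_{ij}\,t^*_{ij\bar v}$. A label $L=(P)$ is a partial path $P$ using arcs of $A$, starting at $0$, ending at a node of $V^0$, and visiting each waypoint at most once. $M(L)$ is the set of waypoints visited so far by $L$ (including $0$). For a partial or complete path $P$, its cumulative adjusted coverage is $c_{\bar v}(P)=\sum_{(i,j)\in P}c^*_{(i,j),\bar v}$, and $c_{\bar v}(L)=c_{\bar v}(P)$ for $L=(P)$. A feasible complete path is a path in $\mathcal P$ that visits $\bar v$ (no extra condition if $\bar v=0$, since every path starts at $0$). An extension of $L=(P)$ to a feasible complete path is a feasible complete path having $P$ as its initial segment.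
   Formalization: In part 2 the minimum defining c^extra(L²) also ranges over the current end waypoint of L², not only over i in V⁰ outside M(L²); without it the rule fails when L² is extended directly to n+1, and the minimum can be empty. *)

theory Defs
  imports "HOL-Analysis.Analysis" "HOL-Library.Sublist"
begin

record 'w coverage_data =
  num :: nat
  wpos :: "nat \<Rightarrow> real^2"
  targets :: "'w set"
  tpos :: "'w \<Rightarrow> real^2"
  priority :: "'w \<Rightarrow> real"
  speed_min :: real
  speed_max :: real
  radius :: real
  factor :: real

definition waypoints :: "'w coverage_data \<Rightarrow> nat set" where
  "waypoints C = {0..num C + 1}"

definition inner_waypoints :: "'w coverage_data \<Rightarrow> nat set" where
  "inner_waypoints C = waypoints C - {0, num C + 1}"

definition arcs :: "'w coverage_data \<Rightarrow> (nat \<times> nat) set" where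
  "arcs C = ((waypoints C - {num C + 1}) \<times> waypoints C)
              - ({(i, i) | i. i \<in> waypoints C} \<union> {(0, num C + 1)})"

definition wdist :: "'w coverage_data \<Rightarrow> nat \<Rightarrow> nat \<Rightarrow> real" where
  "wdist C i j = dist (wpos C i) (wpos C j)"

text \<open>Coverage coefficients. Outside their intended domain (a target lying on a segment it
  would be covered from), the formulas below only have a junk value; that situation is excluded
  by \<open>valid_data\<close>.\<close>

definition covered_segment :: "'w coverage_data \<Rightarrow> nat \<Rightarrow> nat \<Rightarrow> 'w \<Rightarrow> (real^2) set" where
  "covered_segment C i j w =
     closed_segment (wpos C i) (wpos C j) \<inter> cball (tpos C w) (radius C)"

text \<open>The pair \<open>(i', j')\<close>, with \<open>i'\<close> the end closer to \<open>i\<close>; only meaningful if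
  the intersection is nonempty.\<close>

definition covered_ends :: "'w coverage_data \<Rightarrow> nat \<Rightarrow> nat \<Rightarrow> 'w \<Rightarrow> (real^2) \<times> (real^2)" where
  "covered_ends C i j w = (THE (p, q).
     closed_segment p q = covered_segment C i j w \<and> dist (wpos C i) p \<le> dist (wpos C i) q)"

definition vector_angle :: "real^2 \<Rightarrow> real^2 \<Rightarrow> real" where
  "vector_angle x y = arccos ((x \<bullet> y) / (norm x * norm y))"

definition cover_angle :: "'w coverage_data \<Rightarrow> nat \<Rightarrow> nat \<Rightarrow> 'w \<Rightarrow> real" where
  "cover_angle C i j w = (case covered_ends C i j w of (p, q) \<Rightarrow>
     vector_angle (p - tpos C w) (q - tpos C w))"

definition inv_sinc :: "real \<Rightarrow> real" where
  "inv_sinc \<theta> = (if \<theta> = 0 then 1 else \<theta> / sin \<theta>)"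

definition covered_length :: "'w coverage_data \<Rightarrow> nat \<Rightarrow> nat \<Rightarrow> 'w \<Rightarrow> real" where
  "covered_length C i j w =
     (if covered_segment C i j w = {} then 0
      else case covered_ends C i j w of (p, q) \<Rightarrow> dist p q)"

definition arc_coeff :: "'w coverage_data \<Rightarrow> nat \<Rightarrow> nat \<Rightarrow> 'w \<Rightarrow> real" where
  "arc_coeff C i j w =
     (if covered_segment C i j w = {} then 0
      else case covered_ends C i j w of (p, q) \<Rightarrow>
        factor C * (inv_sinc (cover_angle C i j w) / (dist p (tpos C w) * dist q (tpos C w))))"

definition node_coeff :: "'w coverage_data \<Rightarrow> nat \<Rightarrow> 'w \<Rightarrow> real" where
  "node_coeff C i w =
     (if i \<in> inner_waypoints C \<and> dist (wpos C i) (tpos C w) \<le> radius C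
      then factor C / (dist (wpos C i) (tpos C w))\<^sup>2 else 0)"

text \<open>The last two clauses say that no coefficient involves a division by zero.\<close>

definition valid_data :: "'w coverage_data \<Rightarrow> bool" where
  "valid_data C \<longleftrightarrow>
     finite (targets C) \<and>
     0 < speed_min C \<and> speed_min C \<le> speed_max C \<and>
     (\<forall>(i, j) \<in> arcs C. wdist C i j > 0) \<and>
     (\<forall>(i, j) \<in> arcs C. \<forall>w \<in> targets C. covered_segment C i j w \<noteq> {} \<longrightarrow>
        fst (covered_ends C i j w) \<noteq> tpos C w \<and>
        snd (covered_ends C i j w) \<noteq> tpos C w \<and>
        cover_angle C i j w \<noteq> pi) \<and>
     (\<forall>i \<in> inner_waypoints C. \<forall>w \<in> targets C.
        dist (wpos C i) (tpos C w) \<le> radius C \<longrightarrow> wpos C i \<noteq> tpos C w)"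

definition idling_candidates :: "'w coverage_data \<Rightarrow> ('w \<Rightarrow> real) \<Rightarrow> nat set" where
  "idling_candidates C lam =
     {i \<in> inner_waypoints C. (\<Sum>w\<in>targets C. (priority C w - lam w) * node_coeff C i w) > 0} \<union> {0}"

definition arc_gain :: "'w coverage_data \<Rightarrow> ('w \<Rightarrow> real) \<Rightarrow> nat \<Rightarrow> nat \<Rightarrow> nat \<Rightarrow> real" where
  "arc_gain C lam v i j =
     (\<Sum>w\<in>targets C. (priority C w - lam w) *
        (covered_length C i j w / wdist C i j * arc_coeff C i j w - node_coeff C v w))"

definition opt_time :: "'w coverage_data \<Rightarrow> ('w \<Rightarrow> real) \<Rightarrow> nat \<Rightarrow> nat \<Rightarrow> nat \<Rightarrow> real" where
  "opt_time C lam v i j =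
     (if arc_gain C lam v i j > 0 then wdist C i j / speed_min C else wdist C i j / speed_max C)"

definition arc_coverage :: "'w coverage_data \<Rightarrow> ('w \<Rightarrow> real) \<Rightarrow> nat \<Rightarrow> nat \<Rightarrow> nat \<Rightarrow> real" where
  "arc_coverage C lam v i j = arc_gain C lam v i j * opt_time C lam v i j"

text \<open>Paths are lists of visited nodes; the arcs traversed by \<open>P\<close> are \<open>zip P (tl P)\<close>.\<close>

definition simple_path :: "'w coverage_data \<Rightarrow> nat list \<Rightarrow> bool" where
  "simple_path C P \<longleftrightarrow> P \<noteq> [] \<and> distinct P \<and> successively (\<lambda>i j. (i, j) \<in> arcs C) P"

definition depot_paths :: "'w coverage_data \<Rightarrow> nat list set" where
  "depot_paths C = {P. simple_path C P \<and> hd P = 0 \<and> last P = num C + 1}"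

definition label_path :: "'w coverage_data \<Rightarrow> nat list \<Rightarrow> bool" where
  "label_path C L \<longleftrightarrow> simple_path C L \<and> hd L = 0 \<and> last L \<in> inner_waypoints C"

definition visited :: "nat list \<Rightarrow> nat set" where
  "visited L = set L"

definition path_coverage :: "'w coverage_data \<Rightarrow> ('w \<Rightarrow> real) \<Rightarrow> nat \<Rightarrow> nat list \<Rightarrow> real" where
  "path_coverage C lam v P = (\<Sum>(i, j)\<leftarrow>zip P (tl P). arc_coverage C lam v i j)"

definition max_duration :: "'w coverage_data \<Rightarrow> nat list \<Rightarrow> real" where
  "max_duration C P = (\<Sum>(i, j)\<leftarrow>zip P (tl P). wdist C i j / speed_min C)"

text \<open>For \<open>v = 0\<close> the second condition is automatic.\<close>

definition feasible_complete :: "'w coverage_data \<Rightarrow> nat \<Rightarrow> nat list \<Rightarrow> bool" where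
  "feasible_complete C v Q \<longleftrightarrow> Q \<in> depot_paths C \<and> v \<in> set Q"

definition feasible_extension :: "'w coverage_data \<Rightarrow> nat \<Rightarrow> nat list \<Rightarrow> nat list \<Rightarrow> bool" where
  "feasible_extension C v L Q \<longleftrightarrow> feasible_complete C v Q \<and> prefix L Q"

definition dominates ::
    "'w coverage_data \<Rightarrow> ('w \<Rightarrow> real) \<Rightarrow> nat \<Rightarrow> nat list \<Rightarrow> nat list \<Rightarrow> bool" where
  "dominates C lam v L1 L2 \<longleftrightarrow>
     (\<forall>Q2. feasible_extension C v L2 Q2 \<longrightarrow>
        (\<exists>Q1. feasible_extension C v L1 Q1 \<and>
              path_coverage C lam v Q1 \<ge> path_coverage C lam v Q2))"

text \<open>Worst-case extra cost of inserting \<open>v\<close> just before the final depot. The index \<open>i\<close> is the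
  node from which an extension of \<open>L\<close> enters the final depot: either a waypoint not yet visited
  by \<open>L\<close>, or the current waypoint \<open>last L\<close> itself, when \<open>L\<close> is extended directly to the depot.
  The source formula lets \<open>i\<close> range over the inner waypoints outside \<open>visited L\<close> only. Omitting
  \<open>last L\<close> makes the dominance rule false (and the minimum empty if \<open>L\<close> has visited every inner
  waypoint), so \<open>last L\<close> is added to the index set here.\<close>

definition extra_cost :: "'w coverage_data \<Rightarrow> ('w \<Rightarrow> real) \<Rightarrow> nat \<Rightarrow> nat list \<Rightarrow> real" where
  "extra_cost C lam v L =
     (if v = 0 then 0
      else Min ((\<lambda>i. arc_coverage C lam v i v + arc_coverage C lam v v (num C + 1)
                       - arc_coverage C lam v i (num C + 1))
                ` {i \<in> inner_waypoints C. i \<notin> visited L \<or> i = last L}))"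

end

theory Submission
  imports Defs
begin

text \<open>The idea is an exchange argument. An extension of \<open>L2\<close> to the final depot is
  \<open>L2 @ R\<close>, and \<open>R\<close> avoids the nodes of \<open>L2\<close>, hence those of \<open>L1\<close>. Since both labels
  stop at the same waypoint, \<open>L1 @ R\<close> is again a path to the depot
  (\<open>depot_path_exchange\<close>), and because coverage is additive along a path
  (\<open>path_coverage_append\<close>), the two completed paths differ in coverage exactly as the two
  labels do.

  If both labels visit \<open>v\<close> or neither does, then \<open>L1 @ R\<close> also visits \<open>v\<close>, which proves the
  first rule. If only \<open>L2\<close> visits \<open>v\<close>, then \<open>L1 @ R\<close> misses it and is repaired by a detour
  through \<open>v\<close> on the very last arc (\<open>depot_path_detour\<close>). The detour replaces one arc by two,
  so the coverage changes by one of the terms minimised in \<open>extra_cost\<close>: the last node \<open>i\<close>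
  before the depot is \<open>last L2\<close> if \<open>R\<close> consists of the depot alone, and otherwise is a
  waypoint that \<open>L2\<close> has not visited. This proves the second rule.\<close>

text \<open>Repeating the junction \<open>last P\<close> in the second summand accounts for the arc that joins
  \<open>P\<close> to \<open>R\<close>.\<close>

lemma path_coverage_append:
  assumes "P \<noteq> []"
  shows "path_coverage C lam v (P @ R) = path_coverage C lam v P + path_coverage C lam v (last P # R)"
  using assms
proof (induction P rule: list_nonempty_induct)
  case (single x)
  then show ?case by (simp add: path_coverage_def)
next
  case (cons x xs)
  then obtain y ys where "xs = y # ys" by (cases xs) auto
  with cons.IH show ?case by (simp add: path_coverage_def)
qed

lemma path_coverage_detour:
  assumes "P \<noteq> []"
  shows "path_coverage C lam v (P @ [k, e]) = path_coverage C lam v (P @ [e])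
           + (arc_coverage C lam v (last P) k + arc_coverage C lam v k e
                - arc_coverage C lam v (last P) e)"
  unfolding path_coverage_append[OF assms] by (simp add: path_coverage_def)

lemma depot_path_exchange:
  assumes "L2 @ R \<in> depot_paths C" and "R \<noteq> []"
    and "label_path C L1" and "label_path C L2"
    and "last L1 = last L2" and "set L1 \<subseteq> set L2"
  shows "L1 @ R \<in> depot_paths C"
  using assms
  by (auto simp: depot_paths_def label_path_def simple_path_def successively_append_iff)

text \<open>Arcs into the final depot leave from inner waypoints only, because the direct arc between
  the depots is excluded from \<open>arcs\<close>. This puts the last node before the depot into the
  index set of \<open>extra_cost\<close>.\<close>

lemma last_node_before_depot_inner:
  assumes "P @ [num C + 1] \<in> depot_paths C"
  shows "P \<noteq> []" and "last P \<in> inner_waypoints C"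
proof -
  show "P \<noteq> []"
    using assms by (auto simp: depot_paths_def)
  then have "(last P, num C + 1) \<in> arcs C"
    using assms by (auto simp: depot_paths_def simple_path_def successively_append_iff)
  then show "last P \<in> inner_waypoints C"
    by (auto simp: arcs_def inner_waypoints_def)
qed

lemma depot_path_detour:
  assumes path: "P @ [num C + 1] \<in> depot_paths C"
    and k: "k \<in> inner_waypoints C" "k \<notin> set P"
  shows "P @ [k, num C + 1] \<in> depot_paths C"
proof -
  note P = last_node_before_depot_inner[OF path]
  then have "last P \<noteq> k"
    using k(2) last_in_set by metis
  with P(2) k(1) have "(last P, k) \<in> arcs C" "(k, num C + 1) \<in> arcs C"
    by (auto simp: arcs_def inner_waypoints_def waypoints_def)
  moreover have "k \<noteq> num C + 1"
    using k(1) by (simp add: inner_waypoints_def)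
  ultimately show ?thesis
    using path k P(1) by (auto simp: depot_paths_def simple_path_def successively_append_iff)
qed

lemma feasible_extension_of_labelE:
  assumes "feasible_extension C v L Q" and "label_path C L"
  obtains S where "Q = L @ S @ [num C + 1]"
proof -
  obtain R where Q: "Q = L @ R" and "last Q = num C + 1"
    using assms(1)
    by (auto simp: feasible_extension_def feasible_complete_def depot_paths_def prefix_def)
  moreover have "last L \<noteq> num C + 1"
    using assms(2) by (simp add: label_path_def inner_waypoints_def)
  ultimately have R: "R \<noteq> []" "last R = num C + 1"
    by (auto simp: last_append split: if_splits)
  show thesis
    using that[of "butlast R"] append_butlast_last_id[OF R(1)] by (simp add: Q R(2))
qed

lemma extra_cost_le:
  assumes "v \<noteq> 0" and "i \<in> inner_waypoints C" and "i \<notin> set L \<or> i = last L"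
  shows "extra_cost C lam v L \<le> arc_coverage C lam v i v + arc_coverage C lam v v (num C + 1)
           - arc_coverage C lam v i (num C + 1)"
proof -
  have "finite (inner_waypoints C)"
    by (simp add: inner_waypoints_def waypoints_def)
  with assms show ?thesis
    by (auto simp: extra_cost_def visited_def intro!: Min_le)
qed

lemma dominates_same_idling_status:
  assumes labels: "label_path C L1" "label_path C L2"
    and ends: "last L1 = last L2"
    and sub: "set L1 \<subseteq> set L2"
    and status: "v \<in> set L1 \<longleftrightarrow> v \<in> set L2"
    and cov: "path_coverage C lam v L1 \<ge> path_coverage C lam v L2"
  shows "dominates C lam v L1 L2"
  unfolding dominates_def
proof (intro allI impI)
  fix Q2 assume ext: "feasible_extension C v L2 Q2"
  from ext labels(2) obtain S where Q2: "Q2 = L2 @ S @ [num C + 1]"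
    by (rule feasible_extension_of_labelE)
  have ne: "L1 \<noteq> []" "L2 \<noteq> []"
    using labels by (auto simp: label_path_def simple_path_def)
  let ?Q1 = "L1 @ S @ [num C + 1]"
  have Q2_path: "L2 @ S @ [num C + 1] \<in> depot_paths C"
    using ext Q2 by (simp add: feasible_extension_def feasible_complete_def)
  have "?Q1 \<in> depot_paths C"
    using depot_path_exchange[OF Q2_path _ labels ends sub] by simp
  moreover have "v \<in> set ?Q1"
    using ext Q2 status by (auto simp: feasible_extension_def feasible_complete_def)
  ultimately have "feasible_extension C v L1 ?Q1"
    by (simp add: feasible_extension_def feasible_complete_def)
  moreover have "path_coverage C lam v ?Q1 \<ge> path_coverage C lam v Q2"
    using cov by (simp add: Q2 path_coverage_append[OF ne(1)] path_coverage_append[OF ne(2)] ends)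
  ultimately show "\<exists>Q1. feasible_extension C v L1 Q1 \<and>
      path_coverage C lam v Q1 \<ge> path_coverage C lam v Q2"
    by blast
qed

lemma dominates_with_detour:
  assumes labels: "label_path C L1" "label_path C L2"
    and ends: "last L1 = last L2"
    and sub: "set L1 \<subseteq> set L2"
    and v: "v \<in> inner_waypoints C" "v \<notin> set L1" "v \<in> set L2"
    and cov: "path_coverage C lam v L1 + extra_cost C lam v L2 \<ge> path_coverage C lam v L2"
  shows "dominates C lam v L1 L2"
  unfolding dominates_def
proof (intro allI impI)
  fix Q2 assume ext: "feasible_extension C v L2 Q2"
  from ext labels(2) obtain S where Q2: "Q2 = L2 @ S @ [num C + 1]"
    by (rule feasible_extension_of_labelE)
  have ne: "L1 \<noteq> []" "L2 \<noteq> []"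
    using labels by (auto simp: label_path_def simple_path_def)
  have Q2_path: "L2 @ S @ [num C + 1] \<in> depot_paths C"
    using ext Q2 by (simp add: feasible_extension_def feasible_complete_def)
  then have disj: "set L2 \<inter> set S = {}"
    by (auto simp: depot_paths_def simple_path_def)
  let ?P = "L1 @ S"
  have P_path: "?P @ [num C + 1] \<in> depot_paths C"
    using depot_path_exchange[OF Q2_path _ labels ends sub] by simp
  have "?P @ [v, num C + 1] \<in> depot_paths C"
    using depot_path_detour[OF P_path v(1)] v disj by auto
  then have "feasible_extension C v L1 (?P @ [v, num C + 1])"
    by (simp add: feasible_extension_def feasible_complete_def)
  moreover have "path_coverage C lam v Q2 \<le> path_coverage C lam v (?P @ [v, num C + 1])"
  proof -
    have "last ?P \<notin> set L2 \<or> last ?P = last L2"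
    proof (cases "S = []")
      case False
      then have "last ?P \<in> set S" by simp
      with disj show ?thesis by blast
    qed (simp add: ends)
    moreover have "v \<noteq> 0"
      using v(1) by (simp add: inner_waypoints_def)
    ultimately have extra: "extra_cost C lam v L2 \<le> arc_coverage C lam v (last ?P) v
        + arc_coverage C lam v v (num C + 1) - arc_coverage C lam v (last ?P) (num C + 1)"
      using last_node_before_depot_inner(2)[OF P_path] by (intro extra_cost_le) auto
    have "path_coverage C lam v Q2 =
        path_coverage C lam v L2 + path_coverage C lam v (last L2 # S @ [num C + 1])"
      by (simp only: Q2 path_coverage_append[OF ne(2)])
    also have "\<dots> \<le> path_coverage C lam v L1
        + path_coverage C lam v (last L1 # S @ [num C + 1]) + extra_cost C lam v L2"
      using cov by (simp add: ends)
    also have "\<dots> = path_coverage C lam v (?P @ [num C + 1]) + extra_cost C lam v L2"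
      by (simp only: append_assoc path_coverage_append[OF ne(1)])
    also have "\<dots> \<le> path_coverage C lam v (?P @ [v, num C + 1])"
      using extra path_coverage_detour[of ?P C lam v v "num C + 1"] ne(1) by simp
    finally show ?thesis .
  qed
  ultimately show "\<exists>Q1. feasible_extension C v L1 Q1 \<and>
      path_coverage C lam v Q1 \<ge> path_coverage C lam v Q2"
    by blast
qed

theorem proposition3p2:
  fixes C :: "'w coverage_data" and lam :: "'w \<Rightarrow> real" and T :: real
    and v :: nat and L1 L2 :: "nat list"
  assumes "valid_data C"
    and "T \<ge> Max (max_duration C ` depot_paths C)"
    and "v \<in> idling_candidates C lam"
    and "label_path C L1" and "label_path C L2"
    and "last L1 = last L2"
    and "visited L1 \<subseteq> visited L2"
  shows "(((v \<in> visited L1 \<and> v \<in> visited L2) \<or> (v \<notin> visited L1 \<and> v \<notin> visited L2)) \<longrightarrow>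
            path_coverage C lam v L1 \<ge> path_coverage C lam v L2 \<longrightarrow>
            dominates C lam v L1 L2)
       \<and> (v \<notin> visited L1 \<and> v \<in> visited L2 \<and> v \<in> inner_waypoints C \<longrightarrow>
            path_coverage C lam v L1 + extra_cost C lam v L2 \<ge> path_coverage C lam v L2 \<longrightarrow>
            dominates C lam v L1 L2)"
proof (intro conjI impI)
  assume "(v \<in> visited L1 \<and> v \<in> visited L2) \<or> (v \<notin> visited L1 \<and> v \<notin> visited L2)"
    and "path_coverage C lam v L1 \<ge> path_coverage C lam v L2"
  then show "dominates C lam v L1 L2"
    using assms(4-7) by (intro dominates_same_idling_status) (auto simp: visited_def)
next
  assume "v \<notin> visited L1 \<and> v \<in> visited L2 \<and> v \<in> inner_waypoints C"
    and "path_coverage C lam v L1 + extra_cost C lam v L2 \<ge> path_coverage C lam v L2"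
  then show "dominates C lam v L1 L2"
    using assms(4-7) by (intro dominates_with_detour) (auto simp: visited_def)
qed

end
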